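(* Let $\gamma=(a_1\,\dots\,a_k)$ be a cycle on $[n]$ ($k\ge 2$), $A=\mathrm{supp}(\gamma)=\{a_1,\dots,a_k\}$, let $b\in[n]$ with $b>\max A$, and let $j\in\{1,\dots,k\}$. Then for all $\pi\in\Gamma(A\cup\{b\})$, $$x_{\gamma\cdot(a_j\,b)}(\pi)=\varepsilon_{b,a_j}(\pi)\;x_\gamma(\pi\setminus\{b\}),$$ where $\gamma\cdot(a_j\,b)$ is the product (composition) of $\gamma$ with the transposition $(a_j\,b)$.
   Context: Let $[n]=\{1,\dots,n\}$. An injective word over $[n]$ is a finite sequence $\omega=\omega_1\cdots\omega_k$ of distinct elements of $[n]$ ($0\le k\le n$); its content is $c(\omega)=\{\omega_1,\dots,\omega_k\}$. $\Gamma_n$ is the set of all injective words, $\Gamma(A)=\{\omega\in\Gamma_n:c(\omega)=A\}$, and $L(\Gamma_n)$ is the real vector space of functions on $\Gamma_n$, a word being identified with its Dirac function. For $\pi\in\Gamma_n$ and $a\in c(\pi)$, $\pi(a)$ denotes the position of the letter $a$ in $\pi$, and $\pi\setminus\{a\}$ the word obtained by deleting $a$. Permutations compose by $(\sigma\tau)(i)=\sigma(\tau(i))$. A cycle $(a_1\dots a_m)$, with $m\ge2$ distinct letters, maps $a_i\mapsto a_{i+1}$, $a_m\mapsto a_1$ and fixes the other elements of $[n]$; its support is $\{a_1,\dots,a_m\}$. The function $\varepsilon_{b,a}\in L(\Gamma_n)$ is: $\varepsilon_{b,a}(\pi)=1$ if $a,b\in c(\pi)$ and $\pi(b)-\pi(a)=1$;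 $\varepsilon_{b,a}(\pi)=-1$ if $a,b\in c(\pi)$ and $\pi(b)-\pi(a)=-1$; $\varepsilon_{b,a}(\pi)=0$ otherwise. Chains $x_\tau$. The concatenation product $(x,y)\mapsto xy$ on $L(\Gamma_n)$ is the bilinear map sending Dirac functions $(\pi,\pi')$ to the concatenated word $\pi\pi'$ if $c(\pi)\cap c(\pi')=\emptyset$ and to $0$ otherwise; $x\diamond y:=xy-yx$. The standard cycle form of a permutation $\tau\neq id$ of $[n]$ is its expression as a product of disjoint cycles of length $\ge2$, each cycle being written with its minimum element leftmost, and the cycles being arranged from left to right by increasing minimum element. For $\tau\ne id$, the chain $x_\tau\in L(\Gamma(\mathrm{supp}(\tau)))$, $\mathrm{supp}(\tau)=\{i:\tau(i)\neq i\}$, is the output of the following procedure. Write $\tau$ in standard cycle form and insert a symbol $\star$ between each two consecutive letters in each cycle. As long as a symbol $\star$ remains, take the $\star$ whose right-hand neighbor (the letter immediately to its right, ignoring parentheses) is largest; if it appears as $Q\star R$ between quantities $Q$ and $R$ (each a single letter or an already formed parenthesized expression), replace $Q\star R$ by $(Q\diamond R)$. When no $\star$ remains, the string, read as the concatenation product of the expressions coming from the successive cycles (a letter being the corresponding one-letter word), is $x_\tau$. For example $x_{(134)(25)}=(1\diamond(3\diamond4))(2\diamond5)$. *)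

theory Defs
  imports Complex_Main "HOL-Combinatorics.Cycles"
begin

definition inj_words :: "nat \<Rightarrow> nat list set" where
  "inj_words n = {w. distinct w \<and> set w \<subseteq> {1..n}}"

definition words_with_content :: "nat \<Rightarrow> nat set \<Rightarrow> nat list set" where
  "words_with_content n A = {w \<in> inj_words n. set w = A}"

text \<open>Real functions on \<open>inj_words n\<close> are represented by total functions
  \<open>nat list \<Rightarrow> real\<close>, of which only the values on \<open>inj_words n\<close> matter.\<close>

definition dirac :: "nat list \<Rightarrow> nat list \<Rightarrow> real" where
  "dirac w = (\<lambda>\<omega>. if \<omega> = w then 1 else 0)"

definition conc_words :: "nat list \<Rightarrow> nat list \<Rightarrow> nat list \<Rightarrow> real" where
  "conc_words u v = (if set u \<inter> set v = {} then dirac (u @ v) else (\<lambda>\<omega>. 0))"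

text \<open>The bilinear extension of \<open>conc_words\<close> from Dirac functions to all functions.\<close>

definition conc :: "nat \<Rightarrow> (nat list \<Rightarrow> real) \<Rightarrow> (nat list \<Rightarrow> real) \<Rightarrow> nat list \<Rightarrow> real" where
  "conc n x y = (\<lambda>\<omega>. \<Sum>u\<in>inj_words n. \<Sum>v\<in>inj_words n. x u * y v * conc_words u v \<omega>)"

definition diamond :: "nat \<Rightarrow> (nat list \<Rightarrow> real) \<Rightarrow> (nat list \<Rightarrow> real) \<Rightarrow> nat list \<Rightarrow> real" where
  "diamond n x y = (\<lambda>\<omega>. conc n x y \<omega> - conc n y x \<omega>)"

text \<open>The position of a letter occurring in a word, counted from 1.\<close>

definition pos :: "nat list \<Rightarrow> nat \<Rightarrow> nat" where
  "pos w a = Suc (length (takeWhile (\<lambda>c. c \<noteq> a) w))"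

definition eps :: "nat \<Rightarrow> nat \<Rightarrow> nat list \<Rightarrow> real" where
  "eps b a w =
    (if a \<in> set w \<and> b \<in> set w \<and> int (pos w b) - int (pos w a) = 1 then 1
     else if a \<in> set w \<and> b \<in> set w \<and> int (pos w b) - int (pos w a) = -1 then -1
     else 0)"

text \<open>A cycle \<open>(a\<^sub>1 \<dots> a\<^sub>m)\<close> is written as the list \<open>[a\<^sub>1, \<dots>, a\<^sub>m]\<close>;
  \<open>cycle_of_list\<close> maps each letter to the next one and the last letter to the first.\<close>

definition is_standard_cycle_form :: "(nat \<Rightarrow> nat) \<Rightarrow> nat list list \<Rightarrow> bool" where
  "is_standard_cycle_form \<tau> cs \<longleftrightarrow>
     (\<forall>c\<in>set cs. 2 \<le> length c \<and> hd c = Min (set c)) \<and>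
     distinct (concat cs) \<and>
     sorted_wrt (<) (map hd cs) \<and>
     foldr (\<circ>) (map cycle_of_list cs) id = \<tau>"

definition standard_cycle_form :: "(nat \<Rightarrow> nat) \<Rightarrow> nat list list" where
  "standard_cycle_form \<tau> = (THE cs. is_standard_cycle_form \<tau> cs)"

datatype quantity = Letter nat | Diam quantity quantity

fun first_letter :: "quantity \<Rightarrow> nat" where
  "first_letter (Letter a) = a"
| "first_letter (Diam Q R) = first_letter Q"

text \<open>A state of the bracketing procedure is a list of cycles, each being the list of its
  current quantities. The stars are implicit: there is one between any two consecutive
  quantities of the same cycle. \<open>star_letters\<close> lists the right-hand neighbours of the stars;
  they are pairwise distinct as all letters are, so they identify the stars.\<close>

definition star_letters :: "quantity list list \<Rightarrow> nat list" where
  "star_letters qss = concat (map (\<lambda>qs. map first_letter (tl qs)) qss)"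

fun merge_at :: "nat \<Rightarrow> quantity list \<Rightarrow> quantity list" where
  "merge_at m (Q # R # qs) =
     (if first_letter R = m then Diam Q R # qs else Q # merge_at m (R # qs))"
| "merge_at m qs = qs"

lemma length_merge_at:
  "length (merge_at m qs) =
     (if m \<in> first_letter ` set (tl qs) then length qs - 1 else length qs)"
  by (induction m qs rule: merge_at.induct) (auto simp: Suc_diff_Suc neq_Nil_conv)

function bracket :: "quantity list list \<Rightarrow> quantity list list" where
  "bracket qss =
     (if star_letters qss = [] then qss
      else bracket (map (merge_at (Max (set (star_letters qss)))) qss))"
  by auto
termination
proof (relation "measure (\<lambda>qss. sum_list (map length qss))", goal_cases)
  case 1
  show ?case by simp
next
  case (2 qss)
  define m where "m = Max (set (star_letters qss))"
  have "m \<in> set (star_letters qss)"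
    unfolding m_def using 2 by (intro Max_in) auto
  then obtain qs where qs: "qs \<in> set qss" "m \<in> first_letter ` set (tl qs)"
    by (auto simp: star_letters_def)
  have le: "length (merge_at m rs) \<le> length rs" for rs
    by (simp add: length_merge_at)
  have lt: "length (merge_at m qs) < length qs"
    using qs(2) by (cases qs) (auto simp: length_merge_at)
  obtain us vs where "qss = us @ qs # vs"
    using split_list[OF qs(1)] by blast
  moreover have "sum_list (map (length \<circ> merge_at m) xs) \<le> sum_list (map length xs)" for xs
    by (intro sum_list_mono) (simp add: le)
  ultimately show ?case
    unfolding m_def[symmetric] using lt by (simp add: add_le_less_mono add_less_le_mono)
qed

declare bracket.simps [simp del]

lemma bracket_example:
  "bracket (map (map Letter) [[1, 3, 4], [2, 5]]) =
     [[Diam (Letter 1) (Diam (Letter 3) (Letter 4))], [Diam (Letter 2) (Letter 5)]]"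
  by (simp add: bracket.simps star_letters_def)

fun quantity_val :: "nat \<Rightarrow> quantity \<Rightarrow> nat list \<Rightarrow> real" where
  "quantity_val n (Letter a) = dirac [a]"
| "quantity_val n (Diam Q R) = diamond n (quantity_val n Q) (quantity_val n R)"

text \<open>The Dirac function of the empty word is the unit of \<open>conc n\<close>. After \<open>bracket\<close>,
  each cycle consists of a single quantity.\<close>

definition chain :: "nat \<Rightarrow> (nat \<Rightarrow> nat) \<Rightarrow> nat list \<Rightarrow> real" where
  "chain n \<tau> =
     foldr (conc n)
       (map (quantity_val n) (concat (bracket (map (map Letter) (standard_cycle_form \<tau>)))))
       (dirac [])"

end

theory Submission
  imports Defs
begin

text \<open>
  Since \<open>\<gamma> \<circ> transpose a b\<close> sends \<open>a\<close> to \<open>b\<close> and \<open>b\<close> to the old successor of \<open>a\<close>, it is the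
  cycle \<open>\<gamma>\<close> with \<open>b\<close> written just after \<open>a\<close> (\<open>cycle_comp_transpose\<close>). As \<open>b\<close> is not the
  minimum, this is also how the standard cycle form changes. As \<open>b\<close> is the maximum, the first
  star to be processed is the one between \<open>a\<close> and \<open>b\<close>; afterwards \<open>a \<diamond> b\<close> takes part in the
  procedure as the letter \<open>a\<close> did before, because only the first letters of quantities matter.
  So the bracketed expression of the new cycle is that of \<open>\<gamma>\<close> with the leaf \<open>a\<close> replaced by
  \<open>a \<diamond> b\<close> (\<open>bracket_insert_Max\<close>).

  It remains to see what this replacement does to the value of an expression. Every word in the
  support of the value contains \<open>a\<close> exactly once, and the replacement turns this \<open>a\<close> into
  \<open>ab - ba\<close>. Hence the new coefficient of \<open>\<pi>\<close> is the old coefficient of \<open>\<pi>\<close> without \<open>b\<close>,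
  times \<open>1\<close>, \<open>-1\<close> or \<open>0\<close> according to whether \<open>b\<close> stands just after \<open>a\<close>, just before \<open>a\<close> or
  neither; this sign is \<open>eps b a \<pi>\<close>. The formal counterpart is \<open>quantity_val_graft\<close>, an
  induction on the expression which rests on the fact that the operator \<open>insert_letter a b\<close>
  can be pulled out of the factor of a concatenation product in which \<open>a\<close> occurs.
\<close>

section \<open>The concatenation product on homogeneous functions\<close>

definition homogeneous :: "nat \<Rightarrow> (nat list \<Rightarrow> real) \<Rightarrow> bool" where
  "homogeneous m x \<longleftrightarrow> (\<forall>w. x w \<noteq> 0 \<longrightarrow> length w = m)"

lemma finite_inj_words: "finite (inj_words n)"
proof -
  have "inj_words n \<subseteq> {w. set w \<subseteq> {1..n} \<and> length w \<le> n}"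
  proof
    fix w
    assume "w \<in> inj_words n"
    hence w: "distinct w" "set w \<subseteq> {1..n}"
      by (auto simp: inj_words_def)
    have "length w = card (set w)"
      using w(1) by (simp add: distinct_card)
    also have "\<dots> \<le> n"
      using card_mono[OF _ w(2)] by simp
    finally show "w \<in> {w. set w \<subseteq> {1..n} \<and> length w \<le> n}"
      using w(2) by simp
  qed
  thus ?thesis
    by (rule finite_subset) (rule finite_lists_length_le, simp)
qed

lemma conc_nonzeroE:
  assumes "conc n x y w \<noteq> 0"
  obtains u v where "w = u @ v" "x u \<noteq> 0" "y v \<noteq> 0"
proof -
  obtain u where "(\<Sum>v\<in>inj_words n. x u * y v * conc_words u v w) \<noteq> 0"
    using assms unfolding conc_def by (meson sum.neutral)
  then obtain v where "x u * y v * conc_words u v w \<noteq> 0"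
    by (meson sum.neutral)
  thus ?thesis
    using that[of u v] by (auto simp: conc_words_def dirac_def split: if_splits)
qed

text \<open>When all words in the support of the left factor have the same length, only one way of
  cutting a word in two contributes to the product, and the double sum collapses.\<close>

lemma conc_homogeneous:
  assumes "homogeneous m x" "w \<in> inj_words n"
  shows "conc n x y w = x (take m w) * y (drop m w)"
proof -
  let ?u = "take m w" and ?v = "drop m w"
  have in_words: "?u \<in> inj_words n" "?v \<in> inj_words n"
    using assms(2) by (auto simp: inj_words_def dest: in_set_takeD in_set_dropD)
  have disj: "set ?u \<inter> set ?v = {}"
    using assms(2) by (simp add: inj_words_def set_take_disj_set_drop_if_distinct)
  have summand: "x u * y v * conc_words u v w = (if u = ?u then if v = ?v then x ?u * y ?v else 0 else 0)"
    for u v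
  proof (cases "x u = 0")
    case True
    thus ?thesis by auto
  next
    case False
    hence "length u = m"
      using assms(1) by (auto simp: homogeneous_def)
    hence "w = u @ v \<longleftrightarrow> u = ?u \<and> v = ?v"
      by (metis append_eq_conv_conj append_take_drop_id)
    thus ?thesis
      using disj by (auto simp: conc_words_def dirac_def)
  qed
  have "conc n x y w = (\<Sum>u\<in>inj_words n. if u = ?u then x ?u * y ?v else 0)"
    unfolding conc_def summand using in_words finite_inj_words
    by (intro sum.cong) auto
  also have "\<dots> = x ?u * y ?v"
    using in_words finite_inj_words by simp
  finally show ?thesis .
qed

lemma conc_unit_right:
  assumes "homogeneous m x" "w \<in> inj_words n"
  shows "conc n x (dirac []) w = x w"
  using assms(1) by (auto simp: conc_homogeneous[OF assms] dirac_def homogeneous_def)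

section \<open>Inserting a letter next to another one\<close>

lemma pos_append_Cons: "a \<notin> set p \<Longrightarrow> pos (p @ a # q) a = Suc (length p)"
  by (induction p) (auto simp: pos_def)

lemma eps_after:
  assumes "distinct (p @ a # b # q)"
  shows "eps b a (p @ a # b # q) = 1"
  using assms pos_append_Cons[of a p "b # q"] pos_append_Cons[of b "p @ [a]" q]
  by (simp add: eps_def)

lemma eps_before:
  assumes "distinct (p @ b # a # q)"
  shows "eps b a (p @ b # a # q) = -1"
  using assms pos_append_Cons[of b p "a # q"] pos_append_Cons[of a "p @ [b]" q]
  by (simp add: eps_def)

text \<open>Together with \<open>eps_after\<close> and \<open>eps_before\<close>, this replaces positions by decompositions of
  the word, which are easy to cut and to delete from.\<close>

lemma eps_nonzeroE:
  assumes "eps b a w \<noteq> 0" "distinct w"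
  obtains (after) p q where "w = p @ a # b # q"
    | (before) p q where "w = p @ b # a # q"
proof -
  have mem: "a \<in> set w" "b \<in> set w"
    and dist: "\<bar>int (pos w b) - int (pos w a)\<bar> = 1"
    using assms(1) by (auto simp: eps_def split: if_splits)
  obtain p r where w: "w = p @ a # r"
    using mem split_list by metis
  have a: "pos w a = Suc (length p)"
    using assms(2) w by (simp add: pos_append_Cons)
  have "b \<noteq> a"
    using dist by auto
  then consider "b \<in> set p" | "b \<in> set r"
    using mem w by auto
  thus ?thesis
  proof cases
    case 1
    then obtain p1 p2 where p: "p = p1 @ b # p2"
      using split_list by metis
    have "pos w b = Suc (length p1)"
      using assms(2) w p by (simp add: pos_append_Cons)
    hence "p2 = []"
      using dist a p by simp
    thus ?thesis
      using before w p by simp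
  next
    case 2
    then obtain r1 r2 where r: "r = r1 @ b # r2"
      using split_list by metis
    have "pos w b = Suc (length (p @ a # r1))"
      using assms(2) w r pos_append_Cons[of b "p @ a # r1" r2] by simp
    hence "r1 = []"
      using dist a by simp
    thus ?thesis
      using after w r by simp
  qed
qed

text \<open>On Dirac functions this is the linear map that replaces the letter \<open>a\<close> of a word by
  \<open>ab - ba\<close>. The form below computes coefficients instead of images, and is meant to be
  evaluated at words without repetitions.\<close>

definition insert_letter :: "nat \<Rightarrow> nat \<Rightarrow> (nat list \<Rightarrow> real) \<Rightarrow> nat list \<Rightarrow> real" where
  "insert_letter a b x w = eps b a w * x (removeAll b w)"

lemma insert_letter_after:
  assumes "distinct (p @ a # b # q)"
  shows "insert_letter a b x (p @ a # b # q) = x (p @ a # q)"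
  using assms by (auto simp: insert_letter_def eps_after)

lemma insert_letter_before:
  assumes "distinct (p @ b # a # q)"
  shows "insert_letter a b x (p @ b # a # q) = - x (p @ a # q)"
  using assms by (auto simp: insert_letter_def eps_before)

lemma insert_letter_missing:
  "a \<notin> set w \<or> b \<notin> set w \<Longrightarrow> insert_letter a b x w = 0"
  by (auto simp: insert_letter_def eps_def)

text \<open>Letters that are adjacent in a factor are adjacent in the whole word.\<close>

lemma insert_letter_nonadjacent:
  assumes "distinct (u @ v)" "\<nexists>p q. u @ v = p @ a # b # q" "\<nexists>p q. u @ v = p @ b # a # q"
  shows "insert_letter a b x u = 0" "insert_letter a b x v = 0"
proof -
  have "eps b a u = 0"
  proof (rule ccontr)
    assume "eps b a u \<noteq> 0"
    thus False
      using assms by (elim eps_nonzeroE) auto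
  qed
  thus "insert_letter a b x u = 0"
    by (simp add: insert_letter_def)
  have "eps b a v = 0"
  proof (rule ccontr)
    assume "eps b a v \<noteq> 0"
    thus False
      using assms by (elim eps_nonzeroE) (auto, (metis append.assoc)+)
  qed
  thus "insert_letter a b x v = 0"
    by (simp add: insert_letter_def)
qed

definition requires_letter :: "nat \<Rightarrow> (nat list \<Rightarrow> real) \<Rightarrow> bool" where
  "requires_letter a x \<longleftrightarrow> (\<forall>w. x w \<noteq> 0 \<longrightarrow> a \<in> set w)"

text \<open>The next two lemmas are the heart of the argument, stated for the single cut to which a
  product reduces. If the cut leaves \<open>a\<close> and \<open>b\<close> together on the side of the factor that
  requires \<open>a\<close>, then inserting \<open>b\<close> before or after cutting amounts to the same. If the cut
  separates them or leaves both on the other side, then the left-hand side vanishes as the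
  insertion does not see both letters, and the right-hand side as the factor misses \<open>a\<close>.\<close>

lemma insert_letter_split_left:
  assumes "requires_letter a x" "distinct w"
  shows "insert_letter a b x (take (Suc m) w) * y (drop (Suc m) w) =
    insert_letter a b (\<lambda>w. x (take m w) * y (drop m w)) w"
proof -
  consider (after) p q where "w = p @ a # b # q" | (before) p q where "w = p @ b # a # q"
    | (nonadjacent) "\<nexists>p q. w = p @ a # b # q" "\<nexists>p q. w = p @ b # a # q"
    by blast
  thus ?thesis
  proof cases
    case nonadjacent
    hence "insert_letter a b x (take (Suc m) w) = 0"
      using insert_letter_nonadjacent(1)[of "take (Suc m) w" "drop (Suc m) w"] assms(2) by simp
    moreover have "insert_letter a b (\<lambda>w. x (take m w) * y (drop m w)) w = 0"
      using insert_letter_nonadjacent(1)[of w "[]"] assms(2) nonadjacent by simp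
    ultimately show ?thesis by simp
  next
    case (after p q)
    show ?thesis
    proof (cases "length p < m")
      case True
      then obtain l where "m = Suc (length p + l)"
        using less_iff_Suc_add by auto
      moreover have "distinct (p @ a # b # take l q)"
        using after assms(2) by (auto dest: in_set_takeD)
      ultimately show ?thesis
        using after assms(2) by (simp add: insert_letter_after)
    next
      case False
      hence "insert_letter a b x (take (Suc m) w) = 0"
        using after assms(2) by (intro insert_letter_missing)
          (auto simp: take_Cons' dest: in_set_takeD)
      moreover have "x (take m (p @ a # q)) = 0"
        using False after assms by (auto simp: requires_letter_def dest: in_set_takeD)
      ultimately show ?thesis
        using after assms(2) by (simp add: insert_letter_after)
    qed
  next
    case (before p q)
    show ?thesis
    proof (cases "length p < m")
      case True
      then obtain l where "m = Suc (length p + l)"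
        using less_iff_Suc_add by auto
      moreover have "distinct (p @ b # a # take l q)"
        using before assms(2) by (auto dest: in_set_takeD)
      ultimately show ?thesis
        using before assms(2) by (simp add: insert_letter_before)
    next
      case False
      hence "insert_letter a b x (take (Suc m) w) = 0"
        using before assms(2) by (intro insert_letter_missing)
          (auto simp: take_Cons' dest: in_set_takeD)
      moreover have "x (take m (p @ a # q)) = 0"
        using False before assms by (auto simp: requires_letter_def dest: in_set_takeD)
      ultimately show ?thesis
        using before assms(2) by (simp add: insert_letter_before)
    qed
  qed
qed

lemma insert_letter_split_right:
  assumes "requires_letter a y" "distinct w"
  shows "x (take m w) * insert_letter a b y (drop m w) =
    insert_letter a b (\<lambda>w. x (take m w) * y (drop m w)) w"
proof -
  consider (after) p q where "w = p @ a # b # q" | (before) p q where "w = p @ b # a # q"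
    | (nonadjacent) "\<nexists>p q. w = p @ a # b # q" "\<nexists>p q. w = p @ b # a # q"
    by blast
  thus ?thesis
  proof cases
    case nonadjacent
    hence "insert_letter a b y (drop m w) = 0"
      using insert_letter_nonadjacent(2)[of "take m w" "drop m w"] assms(2) by simp
    moreover have "insert_letter a b (\<lambda>w. x (take m w) * y (drop m w)) w = 0"
      using insert_letter_nonadjacent(1)[of w "[]"] assms(2) nonadjacent by simp
    ultimately show ?thesis by simp
  next
    case (after p q)
    show ?thesis
    proof (cases "m \<le> length p")
      case True
      moreover have "distinct (drop m p @ a # b # q)"
        using after assms(2) by (auto dest: in_set_dropD)
      ultimately show ?thesis
        using after assms(2) by (simp add: insert_letter_after)
    next
      case False
      then obtain l where m: "m = Suc (length p + l)"
        using less_iff_Suc_add by (metis not_le)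
      hence "insert_letter a b y (drop m w) = 0"
        using after assms(2) by (intro insert_letter_missing)
          (auto simp: drop_Cons' dest: in_set_dropD)
      moreover have "y (drop m (p @ a # q)) = 0"
        using m after assms by (auto simp: requires_letter_def dest: in_set_dropD)
      ultimately show ?thesis
        using after assms(2) by (simp add: insert_letter_after)
    qed
  next
    case (before p q)
    show ?thesis
    proof (cases "m \<le> length p")
      case True
      moreover have "distinct (drop m p @ b # a # q)"
        using before assms(2) by (auto dest: in_set_dropD)
      ultimately show ?thesis
        using before assms(2) by (simp add: insert_letter_before)
    next
      case False
      then obtain l where m: "m = Suc (length p + l)"
        using less_iff_Suc_add by (metis not_le)
      hence "insert_letter a b y (drop m w) = 0"
        using before assms(2) by (intro insert_letter_missing)
          (auto simp: drop_Cons' dest: in_set_dropD)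
      moreover have "y (drop m (p @ a # q)) = 0"
        using m before assms by (auto simp: requires_letter_def dest: in_set_dropD)
      ultimately show ?thesis
        using before assms(2) by (simp add: insert_letter_before)
    qed
  qed
qed

lemma removeAll_in_inj_words: "w \<in> inj_words n \<Longrightarrow> removeAll b w \<in> inj_words n"
  by (auto simp: inj_words_def distinct_removeAll)

section \<open>Bracketed expressions\<close>

text \<open>All words in the support of the value of an expression are rearrangements of this one
  (\<open>quantity_val_nonzeroD\<close>).\<close>

fun letters :: "quantity \<Rightarrow> nat list" where
  "letters (Letter a) = [a]"
| "letters (Diam Q R) = letters Q @ letters R"

lemma quantity_val_nonzeroD:
  "quantity_val n Q w \<noteq> 0 \<Longrightarrow> mset w = mset (letters Q)"
proof (induction Q arbitrary: w)
  case (Letter a)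
  thus ?case by (auto simp: dirac_def split: if_splits)
next
  case (Diam Q R)
  hence "conc n (quantity_val n Q) (quantity_val n R) w -
      conc n (quantity_val n R) (quantity_val n Q) w \<noteq> 0"
    by (simp add: diamond_def)
  then consider "conc n (quantity_val n Q) (quantity_val n R) w \<noteq> 0"
    | "conc n (quantity_val n R) (quantity_val n Q) w \<noteq> 0"
    by force
  thus ?case
    by cases (auto elim!: conc_nonzeroE dest!: Diam.IH)
qed

lemma homogeneous_quantity_val: "homogeneous (length (letters Q)) (quantity_val n Q)"
  unfolding homogeneous_def by (metis quantity_val_nonzeroD size_mset)

lemma requires_letter_quantity_val:
  "a \<in> set (letters Q) \<Longrightarrow> requires_letter a (quantity_val n Q)"
  unfolding requires_letter_def by (metis quantity_val_nonzeroD set_mset_mset)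

fun graft :: "nat \<Rightarrow> nat \<Rightarrow> quantity \<Rightarrow> quantity" where
  "graft a b (Letter c) = (if c = a then Diam (Letter a) (Letter b) else Letter c)"
| "graft a b (Diam Q R) = Diam (graft a b Q) (graft a b R)"

lemma graft_missing: "a \<notin> set (letters Q) \<Longrightarrow> graft a b Q = Q"
  by (induction Q) auto

lemma length_letters_graft:
  "distinct (letters Q) \<Longrightarrow> a \<in> set (letters Q) \<Longrightarrow>
    length (letters (graft a b Q)) = Suc (length (letters Q))"
proof (induction Q)
  case (Diam Q R)
  then consider "a \<in> set (letters Q)" "a \<notin> set (letters R)"
    | "a \<in> set (letters R)" "a \<notin> set (letters Q)"
    by auto
  thus ?case
    using Diam by cases (simp_all add: graft_missing)
qed simp

text \<open>The function \<open>x'\<close> stands for \<open>insert_letter a b x\<close>. The two need not agree on words with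
  repeated letters, so \<open>x'\<close> is only required to agree with it on injective words.\<close>

lemma conc_insert_letter_left:
  assumes "homogeneous m x" "requires_letter a x" "w \<in> inj_words n"
    and "homogeneous (Suc m) x'" "\<And>u. u \<in> inj_words n \<Longrightarrow> x' u = insert_letter a b x u"
  shows "conc n x' y w = insert_letter a b (conc n x y) w"
proof -
  have "distinct w" "take (Suc m) w \<in> inj_words n"
    using assms(3) by (auto simp: inj_words_def dest: in_set_takeD)
  thus ?thesis
    using insert_letter_split_left[OF assms(2), of w b m y] assms
    by (simp add: conc_homogeneous insert_letter_def removeAll_in_inj_words)
qed

lemma conc_insert_letter_right:
  assumes "homogeneous m x" "requires_letter a y" "w \<in> inj_words n"
    and "\<And>v. v \<in> inj_words n \<Longrightarrow> y' v = insert_letter a b y v"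
  shows "conc n x y' w = insert_letter a b (conc n x y) w"
proof -
  have "distinct w" "drop m w \<in> inj_words n"
    using assms(3) by (auto simp: inj_words_def dest: in_set_dropD)
  thus ?thesis
    using insert_letter_split_right[OF assms(2), of w x m b] assms
    by (simp add: conc_homogeneous insert_letter_def removeAll_in_inj_words)
qed

text \<open>Replacing the leaf \<open>a\<close> by \<open>a \<diamond> b\<close> applies \<open>insert_letter a b\<close> to the value: for a
  single leaf this is the identity \<open>a \<diamond> b = ab - ba\<close>. In a larger expression the
  leaf lies in exactly one of the two operands, and the operator is pulled out of that
  operand in both terms of \<open>\<diamond>\<close>.\<close>

lemma quantity_val_graft:
  assumes "distinct (letters Q)" "a \<in> set (letters Q)" "b \<noteq> a" "w \<in> inj_words n"
  shows "quantity_val n (graft a b Q) w = insert_letter a b (quantity_val n Q) w"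
  using assms(1,2,4)
proof (induction Q arbitrary: w)
  case (Letter c)
  have conc_dirac: "conc n (dirac [c]) (dirac [d]) w = (if w = [c, d] then 1 else 0)" for c d
  proof -
    have "homogeneous 1 (dirac [c])"
      by (simp add: homogeneous_def dirac_def)
    thus ?thesis
      using conc_homogeneous[of 1 "dirac [c]" w n "dirac [d]"] Letter
      by (cases w) (auto simp: dirac_def)
  qed
  have val: "quantity_val n (graft a b (Letter c)) w =
      (if w = [a, b] then 1 else 0) - (if w = [b, a] then 1 else 0)"
    using Letter by (simp add: diamond_def conc_dirac)
  have "distinct w"
    using Letter by (simp add: inj_words_def)
  then consider (after) p q where "w = p @ a # b # q" | (before) p q where "w = p @ b # a # q"
    | (nonadjacent) "eps b a w = 0"
    using eps_nonzeroE by metis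
  thus ?case
  proof cases
    case nonadjacent
    hence "w \<noteq> [a, b]" "w \<noteq> [b, a]"
      using eps_after[of "[]" a b "[]"] eps_before[of "[]" b a "[]"] \<open>b \<noteq> a\<close> by auto
    thus ?thesis
      using nonadjacent unfolding val by (simp add: insert_letter_def)
  next
    case (after p q)
    thus ?thesis
      using Letter(2) \<open>distinct w\<close> \<open>b \<noteq> a\<close> insert_letter_after[of p a b q "dirac [a]"]
      unfolding val
      by (cases p) (auto simp: dirac_def)
  next
    case (before p q)
    thus ?thesis
      using Letter(2) \<open>distinct w\<close> \<open>b \<noteq> a\<close> insert_letter_before[of p b a q "dirac [a]"]
      unfolding val
      by (cases p) (auto simp: dirac_def)
  qed
next
  case (Diam Q R)
  note hom = homogeneous_quantity_val
  have diamond: "insert_letter a b (diamond n x y) w =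
      insert_letter a b (conc n x y) w - insert_letter a b (conc n y x) w" for x y
    by (simp add: insert_letter_def diamond_def right_diff_distrib)
  have hom_graft: "homogeneous (Suc (length (letters P))) (quantity_val n (graft a b P))"
    if "distinct (letters P)" "a \<in> set (letters P)" for P
    using hom[of "graft a b P" n] length_letters_graft[OF that] by simp
  consider (left) "a \<in> set (letters Q)" "a \<notin> set (letters R)"
    | (right) "a \<in> set (letters R)" "a \<notin> set (letters Q)"
    using Diam.prems by auto
  thus ?case
  proof cases
    case left
    have "distinct (letters Q)"
      using Diam.prems by simp
    note IH = Diam.IH(1)[OF this left(1)]
      and req = requires_letter_quantity_val[OF left(1), of n]
      and hg = hom_graft[OF this left(1)]
    show ?thesis
      using conc_insert_letter_left[OF hom req Diam.prems(3) hg IH]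
        conc_insert_letter_right[OF hom req Diam.prems(3) IH]
      by (simp add: graft_missing left diamond diamond_def[of n "quantity_val n (graft a b Q)"])
  next
    case right
    have "distinct (letters R)"
      using Diam.prems by simp
    note IH = Diam.IH(2)[OF this right(1)]
      and req = requires_letter_quantity_val[OF right(1), of n]
      and hg = hom_graft[OF this right(1)]
    show ?thesis
      using conc_insert_letter_left[OF hom req Diam.prems(3) hg IH]
        conc_insert_letter_right[OF hom req Diam.prems(3) IH]
      by (simp add: graft_missing right diamond diamond_def[of n _ "quantity_val n (graft a b R)"])
  qed
qed

section \<open>The bracketing procedure\<close>

lemma first_letter_graft: "first_letter (graft a b Q) = first_letter Q"
  by (induction Q) auto

lemma merge_at_graft: "merge_at m (map (graft a b) qs) = map (graft a b) (merge_at m qs)"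
  by (induction m qs rule: merge_at.induct) (auto simp: first_letter_graft)

lemma star_letters_graft:
  "star_letters (map (map (graft a b)) qss) = star_letters qss"
  by (simp add: star_letters_def map_tl[symmetric] first_letter_graft comp_def)

text \<open>The procedure chooses and merges quantities by their first letters only, and grafting \<open>b\<close>
  to the right of a leaf leaves these unchanged.\<close>

lemma bracket_graft:
  "bracket (map (map (graft a b)) qss) = map (map (graft a b)) (bracket qss)"
proof (induction qss rule: bracket.induct)
  case (1 qss)
  show ?case
  proof (cases "star_letters qss = []")
    case True
    thus ?thesis by (simp add: bracket.simps star_letters_graft)
  next
    case False
    have "map (merge_at m) (map (map (graft a b)) qss) =
        map (map (graft a b)) (map (merge_at m) qss)" for m
      by (simp add: merge_at_graft)
    thus ?thesis
      using 1[OF False] False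
      by (simp add: bracket.simps[of qss] bracket.simps[of "map (map (graft a b)) qss"]
          star_letters_graft del: map_map)
  qed
qed

lemma letters_merge_at: "concat (map letters (merge_at m qs)) = concat (map letters qs)"
  by (induction m qs rule: merge_at.induct) auto

lemma bracket_single_cycle:
  assumes "qs \<noteq> []"
  shows "\<exists>Q. bracket [qs] = [[Q]] \<and> letters Q = concat (map letters qs)"
  using assms
proof (induction qs rule: measure_induct_rule[of length])
  case (less qs)
  show ?case
  proof (cases "tl qs = []")
    case True
    then obtain Q where "qs = [Q]"
      using less.prems by (cases qs) auto
    thus ?thesis by (simp add: bracket.simps star_letters_def)
  next
    case False
    define m where "m = Max (set (star_letters [qs]))"
    have nonempty: "star_letters [qs] \<noteq> []"
      using False by (simp add: star_letters_def)
    hence "m \<in> set (star_letters [qs])"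
      unfolding m_def by (intro Max_in) auto
    hence len: "length (merge_at m qs) = length qs - 1"
      by (simp add: length_merge_at star_letters_def)
    moreover have "length qs \<ge> 2"
      using False by (cases qs; cases "tl qs") auto
    ultimately have "length (merge_at m qs) < length qs" "merge_at m qs \<noteq> []"
      by (auto simp flip: length_greater_0_conv)
    moreover have "bracket [qs] = bracket [merge_at m qs]"
      using nonempty by (simp add: bracket.simps[of "[qs]"] m_def)
    ultimately show ?thesis
      using less.IH[of "merge_at m qs"] by (auto simp: letters_merge_at)
  qed
qed

lemma merge_at_Letters:
  assumes "b \<notin> set (us @ a # vs)"
  shows "merge_at b (map Letter (us @ a # b # vs)) =
    map Letter us @ Diam (Letter a) (Letter b) # map Letter vs"
  using assms
proof (induction us)
  case (Cons u us)
  thus ?case by (cases us) auto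
qed simp

text \<open>The largest letter is the right-hand neighbour of the star processed first. The string
  reached after this one step is a grafted version of the string without \<open>b\<close>.\<close>

lemma bracket_insert_Max:
  assumes "distinct (us @ a # vs)" "\<forall>c\<in>set (us @ a # vs). c < b"
  shows "bracket [map Letter (us @ a # b # vs)] =
    map (map (graft a b)) (bracket [map Letter (us @ a # vs)])"
proof -
  have stars: "star_letters [map Letter (us @ a # b # vs)] = tl (us @ a # b # vs)"
    by (simp add: star_letters_def map_tl comp_def)
  have bound: "y \<le> b" if "y \<in> set (us @ a # b # vs)" for y
    using that assms(2) by (auto intro: less_imp_le)
  have "set (tl (us @ a # b # vs)) \<subseteq> set (us @ a # b # vs)"
    "b \<in> set (tl (us @ a # b # vs))"
    by (cases us; auto)+
  hence max: "Max (set (tl (us @ a # b # vs))) = b"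
    using bound by (intro Max_eqI) blast+
  have "tl (us @ a # b # vs) \<noteq> []"
    by (cases us) auto
  hence "bracket [map Letter (us @ a # b # vs)] = bracket [merge_at b (map Letter (us @ a # b # vs))]"
    by (subst bracket.simps) (simp only: stars max if_False list.map)
  moreover have "map (graft a b) (map Letter (us @ a # vs)) =
      map Letter us @ Diam (Letter a) (Letter b) # map Letter vs"
    using assms(1) by auto
  moreover have "b \<notin> set (us @ a # vs)"
    using assms(2) by blast
  ultimately show ?thesis
    by (simp only: merge_at_Letters[of b us a vs] list.map(1,2) simp_thms flip: bracket_graft)
qed

section \<open>The standard cycle form of a cycle\<close>

lemma cycle_funpow_hd:
  assumes "distinct c" "c \<noteq> []"
  shows "(cycle_of_list c ^^ i) (hd c) = c ! (i mod length c)"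
  using cyclic_rotation[OF assms(1), of i] assms(2)
  by (metis hd_map hd_rotate_conv_nth)

text \<open>Rotating the list so that it starts with \<open>x\<close> does not change the permutation, so the
  orbit can be read off the list.\<close>

lemma cycle_orbit:
  assumes "distinct c" "x \<in> set c"
  shows "range (\<lambda>i. (cycle_of_list c ^^ i) x) = set c"
proof -
  obtain m where m: "m < length c" "x = c ! m"
    using assms(2) by (metis in_set_conv_nth)
  define d where "d = rotate m c"
  have d: "distinct d" "d \<noteq> []" "hd d = x" "set d = set c" "cycle_of_list d = cycle_of_list c"
    using assms m cycle_of_list_rotate_independent[OF assms(1), of m]
    by (auto simp: d_def hd_rotate_conv_nth simp flip: length_greater_0_conv)
  have "set d = range (\<lambda>i. d ! (i mod length d))"
    using d(2) by (auto simp: set_conv_nth image_iff) (metis mod_less)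
  thus ?thesis
    using cycle_funpow_hd[OF d(1,2)] d(3-5) by simp
qed

lemma product_of_cycles_outside:
  "x \<notin> set (concat cs) \<Longrightarrow> foldr (\<circ>) (map cycle_of_list cs) id x = x"
  by (induction cs) (auto simp: id_outside_supp)

lemma product_of_disjoint_cycles_apply:
  assumes "distinct (concat cs)" "d \<in> set cs" "x \<in> set d"
  shows "foldr (\<circ>) (map cycle_of_list cs) id x = cycle_of_list d x"
  using assms
proof (induction cs)
  case (Cons c cs)
  show ?case
  proof (cases "d \<in> set cs")
    case True
    have "cycle_of_list d x \<in> set d"
      using Cons.prems(3) cycle_permutes permutes_in_image by metis
    hence "cycle_of_list d x \<notin> set c"
      using Cons.prems True by auto
    thus ?thesis
      using Cons True by (simp add: id_outside_supp)
  next
    case False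
    hence "d = c"
      using Cons.prems by simp
    hence "x \<notin> set (concat cs)"
      using Cons.prems by auto
    hence "foldr (\<circ>) (map cycle_of_list cs) id x = x"
      by (rule product_of_cycles_outside)
    moreover have "foldr (\<circ>) (map cycle_of_list (c # cs)) id x =
        cycle_of_list c (foldr (\<circ>) (map cycle_of_list cs) id x)"
      by simp
    ultimately show ?thesis
      unfolding \<open>d = c\<close> by (simp only:)
  qed
qed simp

lemma funpow_eq_cycle:
  assumes "\<And>x. x \<in> set c \<Longrightarrow> f x = cycle_of_list c x" "x \<in> set c"
  shows "(f ^^ i) x = (cycle_of_list c ^^ i) x"
proof (induction i)
  case (Suc i)
  have "(cycle_of_list c ^^ i) x \<in> set c"
    using assms(2) permutes_in_image[OF permutes_funpow[OF cycle_permutes]] by metis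
  thus ?case
    using Suc assms(1) by simp
qed simp

lemma cycle_hd_moves:
  assumes "distinct c" "2 \<le> length c"
  shows "cycle_of_list c (hd c) \<noteq> hd c"
proof -
  have "c \<noteq> []" "1 mod length c = 1"
    using assms(2) by auto
  hence "cycle_of_list c (hd c) = c ! 1" "hd c = c ! 0"
    using cycle_funpow_hd[OF assms(1), of 1] by (simp_all add: hd_conv_nth)
  thus ?thesis
    using assms(2) nth_eq_iff_index_eq[OF assms(1), of 1 0] \<open>c \<noteq> []\<close> by auto
qed

text \<open>Only uniqueness needs an argument. The letters of any cycle in a standard cycle form make
  up an orbit of the permutation, which can only be the support of \<open>c\<close>; the minimum and the
  iterates starting from it then determine the list, and disjointness excludes a second copy.\<close>

lemma standard_cycle_form_cycle:
  assumes "distinct c" "2 \<le> length c" "hd c = Min (set c)"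
  shows "standard_cycle_form (cycle_of_list c) = [c]"
  unfolding standard_cycle_form_def
proof (rule the_equality)
  show "is_standard_cycle_form (cycle_of_list c) [c]"
    using assms by (simp add: is_standard_cycle_form_def)
next
  fix cs
  assume cs: "is_standard_cycle_form (cycle_of_list c) cs"
  have dist: "distinct (concat cs)"
    and prod: "foldr (\<circ>) (map cycle_of_list cs) id = cycle_of_list c"
    using cs by (auto simp: is_standard_cycle_form_def)
  have unique: "d = c" if d: "d \<in> set cs" for d
  proof -
    have d': "distinct d" "2 \<le> length d" "hd d = Min (set d)" "d \<noteq> []"
      using cs d by (auto simp: is_standard_cycle_form_def distinct_concat_iff)
    have agree: "cycle_of_list c x = cycle_of_list d x" if "x \<in> set d" for x
      using product_of_disjoint_cycles_apply[OF dist d that] prod by simp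
    have hd: "hd d \<in> set d"
      using d' by simp
    hence pow: "(cycle_of_list c ^^ i) (hd d) = (cycle_of_list d ^^ i) (hd d)" for i
      using funpow_eq_cycle[of d "cycle_of_list c"] agree by blast
    \<comment> \<open>a cycle of length at least 2 moves its letters, and \<open>cycle_of_list c\<close> fixes the others\<close>
    have "hd d \<in> set c"
      using cycle_hd_moves[OF d'(1,2)] agree[OF hd] id_outside_supp[of "hd d" c] by auto
    hence sets: "set d = set c"
      using cycle_orbit[OF assms(1) \<open>hd d \<in> set c\<close>] cycle_orbit[OF d'(1) hd] pow by simp
    hence heads: "hd d = hd c"
      using d' assms by simp
    have len: "length d = length c"
      using sets d'(1) assms(1) by (metis distinct_card)
    show ?thesis
    proof (rule nth_equalityI[OF len])
      fix i
      assume "i < length d"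
      moreover have "c \<noteq> []"
        using assms(2) by auto
      ultimately show "d ! i = c ! i"
        using pow[of i] len cycle_funpow_hd[OF d'(1,4), of i] cycle_funpow_hd[OF assms(1), of i]
        by (simp add: heads)
    qed
  qed
  have "c \<noteq> []"
    using assms(2) by auto
  show "cs = [c]"
  proof (cases cs)
    case Nil
    thus ?thesis
      using prod cycle_hd_moves[OF assms(1,2)] by (metis foldr.simps(1) id_apply list.map(1))
  next
    case (Cons d ds)
    moreover have "ds = []"
    proof (cases ds)
      case (Cons e es)
      hence "d = c" "e = c"
        using unique \<open>cs = d # ds\<close> by auto
      thus ?thesis
        using dist \<open>cs = d # ds\<close> Cons \<open>c \<noteq> []\<close> by auto
    qed simp
    ultimately show ?thesis
      using unique by simp
  qed
qed

lemma cycle_min_first: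
  assumes "distinct c" "c \<noteq> []"
  obtains d :: "nat list" where "distinct d" "set d = set c" "length d = length c"
    "hd d = Min (set d)" "cycle_of_list d = cycle_of_list c"
proof -
  have "Min (set c) \<in> set c"
    using assms(2) by simp
  then obtain m where "m < length c" "c ! m = Min (set c)"
    by (metis in_set_conv_nth)
  thus ?thesis
    using that[of "rotate m c"] cycle_of_list_rotate_independent[OF assms(1), of m] assms
    by (simp add: hd_rotate_conv_nth)
qed

text \<open>With \<open>a\<close> rotated to the front, \<open>cycle_of_list (a # b # w)\<close> unfolds to
  \<open>transpose a b \<circ> cycle_of_list (b # w)\<close>, and \<open>cycle_of_list (b # w)\<close> is
  \<open>cycle_of_list (a # w)\<close> conjugated by the same transposition.\<close>

lemma cycle_comp_transpose:
  assumes "distinct (us @ a # vs)" "b \<notin> set (us @ a # vs)"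
  shows "cycle_of_list (us @ a # vs) \<circ> transpose a b = cycle_of_list (us @ a # b # vs)"
proof -
  let ?t = "transpose a b" and ?w = "vs @ us"
  have "map ?t ?w = ?w"
    using assms by (intro map_idI) (auto simp: transpose_eq_iff)
  hence "?t \<circ> cycle_of_list (a # ?w) \<circ> ?t = cycle_of_list (b # ?w)"
    using conjugation_of_cycle[of "a # ?w" ?t] assms by auto
  hence "cycle_of_list (a # b # ?w) = ?t \<circ> (?t \<circ> cycle_of_list (a # ?w) \<circ> ?t)"
    by simp
  also have "\<dots> = cycle_of_list (a # ?w) \<circ> ?t"
    by (simp only: fun_eq_iff o_apply transpose_involutory) simp
  finally have "cycle_of_list (a # b # ?w) = cycle_of_list (a # ?w) \<circ> ?t" .
  moreover have "cycle_of_list (us @ a # vs) = cycle_of_list (a # ?w)"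
    using cycle_of_list_rotate_independent[OF assms(1), of "length us"]
    by (simp add: rotate_append)
  moreover have "distinct (us @ a # b # vs)"
    using assms by auto
  hence "cycle_of_list (us @ a # b # vs) = cycle_of_list (a # b # ?w)"
    using cycle_of_list_rotate_independent[of "us @ a # b # vs" "length us"]
    by (simp add: rotate_append)
  ultimately show ?thesis by simp
qed

section \<open>Chains of cycles\<close>

lemma chain_cycle:
  assumes "distinct c" "2 \<le> length c" "hd c = Min (set c)"
    and "bracket [map Letter c] = [[Q]]" "w \<in> inj_words n"
  shows "chain n (cycle_of_list c) w = quantity_val n Q w"
  using standard_cycle_form_cycle[OF assms(1-3)] assms(4,5)
  by (simp add: chain_def conc_unit_right[OF homogeneous_quantity_val])

theorem theorem6:
  fixes n k j b :: nat and as :: "nat list" and \<gamma> :: "nat \<Rightarrow> nat" and A :: "nat set"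
    and \<pi> :: "nat list"
  assumes "2 \<le> k" and "length as = k" and "distinct as" and "set as \<subseteq> {1..n}"
    and "\<gamma> = cycle_of_list as" and "A = set as"
    and "b \<in> {1..n}" and "b > Max A"
    and "j \<in> {1..k}"
    and "\<pi> \<in> words_with_content n (A \<union> {b})"
  shows "chain n (\<gamma> \<circ> transpose (as ! (j - 1)) b) \<pi> =
         eps b (as ! (j - 1)) \<pi> * chain n \<gamma> (removeAll b \<pi>)"
proof -
  define a where "a = as ! (j - 1)"
  have "as \<noteq> []"
    using assms(1,2) by auto
  then obtain d where d: "distinct d" "set d = set as" "length d = length as"
    "hd d = Min (set d)" "cycle_of_list d = cycle_of_list as"
    by (rule cycle_min_first[OF assms(3)])
  have len: "2 \<le> length d"
    using assms(1,2) d(3) by simp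
  have \<gamma>: "\<gamma> = cycle_of_list d"
    using assms(5) d(5) by simp
  have "j - 1 < length as"
    using assms(1,2,9) by auto
  hence "a \<in> set d"
    unfolding a_def d(2) by (rule nth_mem)
  then obtain us vs where d_split: "d = us @ a # vs"
    using split_list by metis
  let ?e = "us @ a # b # vs"
  have less: "\<forall>c\<in>set d. c < b"
    using assms(6,8) d(2) \<open>as \<noteq> []\<close> by simp
  hence b_new: "b \<notin> set d"
    by blast
  \<comment> \<open>\<open>b\<close> is neither first nor minimal, so the new list is again in standard form\<close>
  have "hd ?e = hd d"
    by (cases us) (auto simp: d_split)
  moreover have "set ?e = insert b (set d)"
    by (auto simp: d_split)
  moreover have "Min (set d) \<in> set d"
    using \<open>a \<in> set d\<close> by (intro Min_in) auto
  hence "Min (insert b (set d)) = Min (set d)"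
    using less by (intro Min_eqI) (auto intro: less_imp_le)
  ultimately have hd_e: "hd ?e = Min (set ?e)"
    using d(4) by simp
  have e: "distinct ?e" "2 \<le> length ?e"
    using d(1) b_new len by (auto simp: d_split)
  have "map Letter d \<noteq> []"
    using len by auto
  then obtain Q where Q: "bracket [map Letter d] = [[Q]]" "letters Q = d"
    using bracket_single_cycle[of "map Letter d"]
    by (auto simp: comp_def)
  have graft: "bracket [map Letter ?e] = [[graft a b Q]]"
    using bracket_insert_Max[of us a vs b] d(1) less Q(1) by (simp add: d_split)
  have \<pi>: "\<pi> \<in> inj_words n"
    using assms(10) by (simp add: words_with_content_def)
  have "chain n (\<gamma> \<circ> transpose a b) \<pi> = chain n (cycle_of_list ?e) \<pi>"
    using cycle_comp_transpose[of us a vs b] d(1) b_new by (simp add: \<gamma> d_split)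
  also have "\<dots> = quantity_val n (graft a b Q) \<pi>"
    by (rule chain_cycle[OF e hd_e graft \<pi>])
  also have "\<dots> = eps b a \<pi> * quantity_val n Q (removeAll b \<pi>)"
    using quantity_val_graft[of Q a b \<pi> n] Q(2) d(1) \<open>a \<in> set d\<close> b_new \<pi>
    by (auto simp: insert_letter_def)
  also have "quantity_val n Q (removeAll b \<pi>) = chain n \<gamma> (removeAll b \<pi>)"
    using chain_cycle[OF d(1) len d(4) Q(1) removeAll_in_inj_words[OF \<pi>]]
    by (simp add: \<gamma>)
  finally show ?thesis
    unfolding a_def .
qed

end
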